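(* For any string $S$ over the binary alphabet $\Sigma_2 = \{\mathtt{0},\mathtt{1}\}$ with $|S| = d \ge 1$, $$|\mathsf{MAW}(S) \bigtriangleup \mathsf{MAW}(S\mathtt{0})| \le \max\{3,d\},$$ and this upper bound is tight for any $d \ge 1$: for every $d \ge 1$ there is a string $S$ over $\Sigma_2$ with $|S| = d$ and $|\mathsf{MAW}(S) \bigtriangleup \mathsf{MAW}(S\mathtt{0})| = \max\{3,d\}$.
   Context: A string $w$ occurs in $S$ if it is a (contiguous) substring of $S$; the empty string occurs in every string. A non-empty string $w \in \Sigma_2^*$ is a minimal absent word (MAW) for $S$ if $w$ does not occur in $S$ but every proper substring of $w$ occurs in $S$ (in particular a character of $\Sigma_2$ not occurring in $S$ is a MAW for $S$). $\mathsf{MAW}(S)$ is the set of all MAWs for $S$ relative to the alphabet $\Sigma_2$. $\bigtriangleup$ denotes symmetric difference, and $S\mathtt{0}$ is $S$ with the character $\mathtt{0}$ appended on the right. *)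

theory Defs
  imports Main "HOL-Library.Sublist"
begin

datatype bin = Zero ("\<zero>") | One ("\<one>")

text \<open>
  The alphabet is the whole element type, so a character that does not occur in \<open>S\<close>
  yields a minimal absent word of length one. Substrings are contiguous, as in
  \<^const>\<open>sublist\<close>.
\<close>

definition MAW :: "'a list \<Rightarrow> 'a list set" where
  "MAW S = {w. w \<noteq> [] \<and> \<not> sublist w S \<and> (\<forall>v. strict_sublist v w \<longrightarrow> sublist v S)}"

text \<open>Over a finite alphabet \<^term>\<open>MAW S\<close> is finite, so \<^const>\<open>card\<close> counts it faithfully.\<close>

lemma length_MAW_le:
  assumes "w \<in> MAW S"
  shows "length w \<le> Suc (length S)"
proof -
  obtain a v where w: "w = a # v"
    using assms by (cases w) (auto simp: MAW_def)
  have "strict_sublist v w"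
    unfolding w strict_sublist_def by (auto simp: sublist_Cons_right)
  then have "sublist v S"
    using assms by (auto simp: MAW_def)
  then show ?thesis
    using w sublist_length_le by fastforce
qed

lemma finite_MAW: "finite (MAW (S :: bin list))"
proof -
  have "finite (UNIV :: bin set)"
    using finite.simps[of "UNIV :: bin set"] by (metis bin.exhaust UNIV_eq_I finite.emptyI finite_insert insertI1 insertI2)
  then have "finite {w :: bin list. set w \<subseteq> UNIV \<and> length w \<le> Suc (length S)}"
    by (rule finite_lists_length_le)
  then show ?thesis
    by (rule rev_finite_subset) (auto dest: length_MAW_le)
qed

end

theory Submission
  imports Defs
begin

text \<open>
  Let \<open>T = S@[c]\<close> and let \<open>l\<close> be the length of the longest suffix of \<open>T\<close> occurring in \<open>S\<close>.
  The suffix \<open>p\<close> of \<open>T\<close> of length \<open>l + 1\<close> is the only MAW that disappears. A new MAW is either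
  \<open>p@[b]\<close> for some \<open>b\<close>, or a left extension \<open>a # u @ [c]\<close> where the suffix \<open>u\<close> of \<open>S\<close>
  reoccurs in \<open>S\<close> preceded by \<open>a\<close>. Over a binary alphabet the latter are determined by their
  lengths, which lie between \<open>l + 2\<close> and \<open>d\<close>. If \<open>l = 0\<close>, then \<open>S\<close> consists of \<open>\<one>\<close> only and there
  are no such left extensions. If \<open>l \<ge> 1\<close>, the count \<open>1 + 2 + (d - 1 - l)\<close> exceeds the bound only
  when length \<open>d\<close> is attained; then \<open>S\<close> is \<open>\<zero>\<close> followed by \<open>d - 1\<close> copies of \<open>\<one>\<close>, and only
  one \<open>p@[b]\<close> is a MAW. This string also attains the bound for \<open>d \<ge> 3\<close>.
\<close>

section \<open>Absent words tested on their two longest proper factors\<close>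

lemma sublist_tl_or_butlast:
  assumes "strict_sublist v w"
  shows "sublist v (tl w) \<or> sublist v (butlast w)"
proof -
  obtain x y where w: "w = x @ v @ y" and ne: "x \<noteq> [] \<or> y \<noteq> []"
    using assms unfolding strict_sublist_def sublist_def by (metis append_Nil append_Nil2)
  show ?thesis
  proof (cases "x = []")
    case True
    then have "butlast w = v @ butlast y" using w ne by (simp add: butlast_append)
    then show ?thesis by simp
  next
    case False
    then have "tl w = tl x @ v @ y" using w by simp
    then show ?thesis unfolding sublist_def by blast
  qed
qed

text \<open>Every proper factor lies inside the tail or inside \<open>butlast\<close>, so these two
  decide whether an absent word is minimal.\<close>

lemma MAW_iff:
  "w \<in> MAW S \<longleftrightarrow> w \<noteq> [] \<and> \<not> sublist w S \<and> sublist (tl w) S \<and> sublist (butlast w) S"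
proof -
  have "strict_sublist (tl w) w" "strict_sublist (butlast w) w" if "w \<noteq> []"
    using that by (cases w rule: rev_cases; cases w; auto simp: strict_sublist_def sublist_Cons_right
      intro: sublist_butlast sublist_tl dest: arg_cong[where f = length])+
  then show ?thesis
    unfolding MAW_def using sublist_tl_or_butlast by (blast intro: sublist_order.order.trans)
qed

section \<open>Suffixes of the extended string that recur in \<open>S\<close>\<close>

lemma same_length_suffix_eq:
  "suffix u S \<Longrightarrow> suffix v S \<Longrightarrow> length u = length v \<Longrightarrow> u = v"
  by (auto simp: suffix_def)

text \<open>Occurrence in \<open>S\<close> passes to shorter suffixes, so one threshold describes
  all suffixes at once.\<close>

definition recurs_upto :: "'a list \<Rightarrow> 'a \<Rightarrow> nat \<Rightarrow> bool" where
  "recurs_upto S c l \<longleftrightarrow> (\<forall>v. suffix v (S @ [c]) \<longrightarrow> (sublist v S \<longleftrightarrow> length v \<le> l))"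

lemma recurs_uptoD:
  "recurs_upto S c l \<Longrightarrow> suffix v (S @ [c]) \<Longrightarrow> sublist v S \<longleftrightarrow> length v \<le> l"
  unfolding recurs_upto_def by blast

lemma ex_recurs_upto: "\<exists>l. recurs_upto S c l"
proof -
  let ?A = "{v. suffix v (S @ [c]) \<and> sublist v S}"
  have fin: "finite (length ` ?A)"
    by (rule finite_subset[of _ "{..length S}"]) (auto dest: sublist_length_le)
  have "[] \<in> ?A" by simp
  then have "Max (length ` ?A) \<in> length ` ?A" using fin by (intro Max_in) auto
  then obtain m where m: "m \<in> ?A" "length m = Max (length ` ?A)" by fastforce
  have "recurs_upto S c (length m)"
    unfolding recurs_upto_def
  proof (intro allI impI)
    fix v assume v: "suffix v (S @ [c])"
    show "sublist v S \<longleftrightarrow> length v \<le> length m"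
    proof
      assume "sublist v S"
      then show "length v \<le> length m" using v m fin by auto
    next
      assume "length v \<le> length m"
      then have "suffix v m" using v m suffix_length_suffix by blast
      then show "sublist v S" using m sublist_order.order.trans suffix_imp_sublist by blast
    qed
  qed
  then show ?thesis ..
qed

lemma sublist_replicate_iff:
  "sublist xs (replicate n y) \<longleftrightarrow> length xs \<le> n \<and> xs = replicate (length xs) y"
proof
  assume *: "sublist xs (replicate n y)"
  have "set xs \<subseteq> {y}" using set_mono_sublist[OF *] by (auto split: if_splits)
  then show "length xs \<le> n \<and> xs = replicate (length xs) y"
    using sublist_length_le[OF *] by (auto intro: replicate_eqI)
next
  assume *: "length xs \<le> n \<and> xs = replicate (length xs) y"
  then have "replicate n y = xs @ replicate (n - length xs) y"
    by (metis le_add_diff_inverse replicate_add)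
  then show "sublist xs (replicate n y)" by simp
qed

text \<open>The word agrees with its own shift by one place, so each letter equals the next and the
  last equals \<open>y\<close>.\<close>

lemma snoc_eq_Cons_imp_replicate: "xs @ [y] = z # xs \<Longrightarrow> xs = replicate (length xs) y"
proof (induction xs arbitrary: z)
  case (Cons x xs)
  then have xs: "xs = replicate (length xs) y" and "xs @ [y] = x # xs" by auto
  then have "x = y" by (metis append_Cons list.inject replicate_append_same)
  then show ?case using xs by simp
qed simp

section \<open>Words lost and gained by appending a letter\<close>

text \<open>The third condition keeps the word from being a suffix of \<open>S @ [c]\<close>; the
  fourth keeps its tail out of \<open>S\<close>, so it is not minimal for \<open>S\<close>.\<close>

definition left_ext :: "'a list \<Rightarrow> 'a \<Rightarrow> 'a list set" where
  "left_ext S c = {a # u @ [c] | a u. sublist (a # u) S \<and> suffix u S \<and>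
     \<not> suffix (a # u) S \<and> \<not> sublist (u @ [c]) S}"

lemma left_ext_subset: "left_ext S c \<subseteq> MAW (S @ [c]) - MAW S"
proof
  fix w assume "w \<in> left_ext S c"
  then obtain a u where w: "w = a # u @ [c]" "sublist (a # u) S" "suffix u S"
     "\<not> suffix (a # u) S" "\<not> sublist (u @ [c]) S"
    by (auto simp: left_ext_def)
  have "\<not> sublist w S" using w(1,5) sublist_order.order.trans[of "u @ [c]" w S] by (auto simp: sublist_Cons_right)
  moreover have "\<not> suffix w (S @ [c])" using w(1,4) suffix_snoc[of "a # u @ [c]" S c] by auto
  moreover have "suffix (u @ [c]) (S @ [c])" using w(3) by simp
  ultimately show "w \<in> MAW (S @ [c]) - MAW S"
    using w by (auto simp: MAW_iff sublist_snoc butlast_append)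
qed

text \<open>A lost word has become a suffix of \<open>S @ [c]\<close>; it is absent from
  \<open>S\<close> but its tail is not, so its length is one past the threshold.\<close>

lemma MAW_lost_subset:
  assumes "w \<in> MAW S - MAW (S @ [c])"
    and l: "recurs_upto S c l"
  shows "suffix w (S @ [c]) \<and> length w = Suc l"
proof -
  have w: "w \<noteq> []" "\<not> sublist w S" "sublist (tl w) S" "suffix w (S @ [c])"
    using assms(1) by (auto simp: MAW_iff sublist_snoc)
  then have "suffix (tl w) (S @ [c])" using suffix_order.trans suffix_tl by blast
  then show ?thesis using w recurs_uptoD[OF l, of w] recurs_uptoD[OF l, of "tl w"] by simp
qed

text \<open>The tail or \<open>butlast\<close> must be missing from \<open>S\<close>. If
  \<open>butlast\<close> occurs there, the missing tail is a suffix and the word is a left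
  extension; otherwise \<open>butlast\<close> is the shortest suffix that does not recur.\<close>

lemma MAW_gained_cases:
  assumes "w \<in> MAW (S @ [c]) - MAW S"
    and l: "recurs_upto S c l"
  shows "(\<exists>p b. w = p @ [b] \<and> suffix p (S @ [c]) \<and> length p = Suc l) \<or> w \<in> left_ext S c"
proof -
  have w: "w \<noteq> []" "\<not> sublist w S" "\<not> suffix w (S @ [c])"
    and or: "\<not> sublist (tl w) S \<or> \<not> sublist (butlast w) S"
    and "sublist (tl w) (S @ [c])" "sublist (butlast w) (S @ [c])"
    using assms(1) by (auto simp: MAW_iff sublist_snoc)
  then have tl: "sublist (tl w) S \<or> suffix (tl w) (S @ [c])"
    and bl: "sublist (butlast w) S \<or> suffix (butlast w) (S @ [c])"
    by (auto simp: sublist_snoc)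
  \<comment> \<open>A single letter has empty tail and \<open>butlast\<close>, which occur in
    \<open>S\<close>.\<close>
  have "length w \<noteq> 1" using or by (cases w) auto
  then obtain a u b where aub: "w = a # u @ [b]" using w(1)
    by (cases w; cases "tl w" rule: rev_cases) auto
  have ub: "sublist (u @ [b]) S \<or> suffix (u @ [b]) (S @ [c])" using tl aub by simp
  have au: "sublist (a # u) S \<or> suffix (a # u) (S @ [c])" using bl aub by (simp add: butlast_append)
  show ?thesis
  proof (cases "sublist (a # u) S")
    case True
    then have nub: "\<not> sublist (u @ [b]) S" using or aub by (simp add: butlast_append)
    then have "b = c" "suffix u S" using ub by auto
    moreover have "\<not> suffix (a # u) S" using w(3) aub \<open>b = c\<close> suffix_snoc[of w S c] by auto
    ultimately show ?thesis using True nub aub by (auto simp: left_ext_def)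
  next
    case False
    then have suf: "suffix (a # u) (S @ [c])" using au by simp
    then have suf': "suffix u (S @ [c])" using suffix_ConsD by metis
    have "sublist u S"
    proof (cases "sublist (u @ [b]) S")
      case True
      then show ?thesis by (rule sublist_order.order.trans[rotated]) simp
    next
      case False
      then have "suffix u S" using ub by auto
      then show ?thesis by (rule suffix_imp_sublist)
    qed
    then have "length (a # u) = Suc l" using recurs_uptoD[OF l suf] recurs_uptoD[OF l suf'] False by simp
    then show ?thesis using suf aub by (metis append_Cons)
  qed
qed

section \<open>Lengths of left extensions\<close>

text \<open>The length fixes the suffix \<open>u\<close> of \<open>S\<close>, and \<open>a\<close>
  must differ from the letter before that suffix, which leaves one choice of two letters.\<close>

lemma inj_on_length_left_ext: "inj_on length (left_ext S (c :: bin))"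
proof (rule inj_onI)
  fix v w assume "v \<in> left_ext S c" "w \<in> left_ext S c" and len: "length v = length w"
  then obtain a u a' u' where v: "v = a # u @ [c]" "sublist (a # u) S" "suffix u S" "\<not> suffix (a # u) S"
    and w: "w = a' # u' @ [c]" "suffix u' S" "\<not> suffix (a' # u') S"
    unfolding left_ext_def by blast
  have u: "u' = u" using v w len same_length_suffix_eq[of u' S u] by simp
  obtain y where y: "S = y @ u" using v(3) by (auto simp: suffix_def)
  have "y \<noteq> []" using y sublist_length_le[OF v(2)] by auto
  then obtain z x where "y = z @ [x]" by (cases y rule: rev_cases) auto
  then have "suffix (x # u) S" using y by (auto simp: suffix_def)
  then have "a \<noteq> x" "a' \<noteq> x" using v w u by auto
  then show "v = w" using v w u by (cases a; cases a'; cases x) auto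
qed

text \<open>An occurrence of \<open>a # u\<close> that is not a suffix leaves a letter of
  \<open>S\<close> to its right, which makes room for \<open>c\<close>.\<close>

lemma length_left_ext_le:
  assumes "w \<in> left_ext S c"
  shows "length w \<le> length S"
proof -
  obtain a u where w: "w = a # u @ [c]" "sublist (a # u) S" "\<not> suffix (a # u) S"
    using assms unfolding left_ext_def by blast
  then obtain x y where S: "S = x @ (a # u) @ y" unfolding sublist_def by blast
  then have "y \<noteq> []" using w(3) by (auto simp: suffix_def)
  then show ?thesis using S w(1) by (cases y) auto
qed

lemma length_left_ext_ge:
  assumes "w \<in> left_ext S c"
    and l: "recurs_upto S c l"
  shows "l + 2 \<le> length w"
proof -
  obtain a u where w: "w = a # u @ [c]" "suffix u S" "\<not> sublist (u @ [c]) S"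
    using assms unfolding left_ext_def by blast
  then show ?thesis using recurs_uptoD[OF l, of "u @ [c]"] by simp
qed

text \<open>Here \<open>a # u\<close> misses just one letter of \<open>S\<close>, so
  \<open>S = a # u @ [b]\<close>; since \<open>u\<close> is also a suffix, it is invariant under a
  shift and hence constant.\<close>

lemma left_ext_length_eq:
  assumes "w \<in> left_ext S (\<zero>)" "length w = length S" "3 \<le> length S"
  shows "S = \<zero> # replicate (length S - 1) \<one>"
proof -
  obtain a u where w: "w = a # u @ [\<zero>]" "sublist (a # u) S" "suffix u S" "\<not> suffix (a # u) S"
      "\<not> sublist (u @ [\<zero>]) S"
    using assms(1) unfolding left_ext_def by blast
  obtain x y where S: "S = x @ (a # u) @ y" using w(2) unfolding sublist_def by blast
  then have "y \<noteq> []" using w(4) by (auto simp: suffix_def)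
  moreover have "length x + length y = 1" using S w(1) assms(2) by simp
  ultimately obtain b where "x = []" "y = [b]" by (cases y) auto
  then have S: "S = a # u @ [b]" using S by simp
  have "suffix (tl (u @ [b])) S" unfolding S by (rule suffix_ConsI[OF suffix_tl])
  then have "tl (u @ [b]) = u" using w(3) by (rule same_length_suffix_eq) simp
  then have "u @ [b] = hd (u @ [b]) # u" by (metis append_is_Nil_conv list.collapse not_Cons_self2)
  then have u: "u = replicate (length u) b" by (rule snoc_eq_Cons_imp_replicate)
  then have ub: "u @ [b] = b # u" by (metis replicate_append_same)
  \<comment> \<open>Otherwise \<open>a # u\<close> equals \<open>u @ [b]\<close> and is a suffix of
    \<open>S\<close>.\<close>
  then have "a \<noteq> b" using w(4) S by (auto simp: suffix_def)
  moreover have "b \<noteq> \<zero>" using w(5) S by (auto simp: sublist_Cons_right)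
  ultimately have "a = \<zero>" "b = \<one>" by (cases a; cases b; simp)+
  then show ?thesis using S u ub by (metis length_Cons diff_Suc_1 replicate_Suc)
qed

text \<open>In a power of one letter every factor is also a suffix.\<close>

lemma left_ext_replicate: "left_ext (replicate n x) c = {}"
proof -
  have False if "sublist (a # u) (replicate n x)" "\<not> suffix (a # u) (replicate n x)" for a u
  proof -
    have "length (a # u) \<le> n" and au: "a # u = replicate (length (a # u)) x"
      using that(1) unfolding sublist_replicate_iff by auto
    then have "replicate n x = replicate (n - length (a # u)) x @ replicate (length (a # u)) x"
      by (metis le_add_diff_inverse2 replicate_add)
    then show False using that(2) au unfolding suffix_def by metis
  qed
  then show ?thesis unfolding left_ext_def by blast
qed

lemma card_left_ext_le:
  assumes "length ` left_ext S (c :: bin) \<subseteq> {i..j}"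
  shows "card (left_ext S c) \<le> Suc j - i"
  using card_mono[OF _ assms] card_image[OF inj_on_length_left_ext, of S c] by simp

section \<open>Counting the symmetric difference from above\<close>

lemma finite_left_ext: "finite (left_ext S (c :: bin))"
  using finite_subset[OF left_ext_subset finite_Diff[OF finite_MAW]] .

text \<open>The intersection with \<open>MAW\<close> stays in the bound because one right extension
  of \<open>p\<close> has to be discarded in the extremal case.\<close>

lemma card_sym_diff_le:
  fixes S :: "bin list"
  assumes "suffix p (S @ [c])" "length p = Suc l"
    and l: "recurs_upto S c l"
  shows "card (sym_diff (MAW S) (MAW (S @ [c])))
    \<le> 1 + card ({p @ [\<zero>], p @ [\<one>]} \<inter> MAW (S @ [c])) + card (left_ext S c)"
proof -
  let ?N = "{p @ [\<zero>], p @ [\<one>]} \<inter> MAW (S @ [c])"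
  have "MAW S - MAW (S @ [c]) \<subseteq> {p}"
    using MAW_lost_subset[OF _ l] assms(1,2) same_length_suffix_eq by fastforce
  moreover have "MAW (S @ [c]) - MAW S \<subseteq> ?N \<union> left_ext S c"
  proof
    fix w assume w: "w \<in> MAW (S @ [c]) - MAW S"
    from MAW_gained_cases[OF w l] show "w \<in> ?N \<union> left_ext S c"
    proof (elim disjE exE conjE)
      fix q b assume q: "w = q @ [b]" "suffix q (S @ [c])" "length q = Suc l"
      then have "q = p" using assms(1,2) same_length_suffix_eq by metis
      then show ?thesis using q w by (cases b) auto
    qed auto
  qed
  ultimately have "card (sym_diff (MAW S) (MAW (S @ [c]))) \<le> card ({p} \<union> (?N \<union> left_ext S c))"
    using finite_left_ext by (intro card_mono) auto
  also have "\<dots> \<le> card {p} + card (?N \<union> left_ext S c)" by (rule card_Un_le)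
  also have "\<dots> \<le> card {p} + (card ?N + card (left_ext S c))"
    using card_Un_le[of ?N] by simp
  finally show ?thesis by simp
qed

lemma not_sublist_one_zero: "\<not> sublist (replicate (Suc m) \<one> @ [\<zero>]) (\<zero> # replicate n \<one>)"
proof -
  have "\<zero> \<notin> set (replicate n \<one>)" by simp
  then have "\<not> sublist (replicate (Suc m) \<one> @ [\<zero>]) (replicate n \<one>)"
    using set_mono_sublist[of "replicate (Suc m) \<one> @ [\<zero>]" "replicate n \<one>"] by auto
  then show ?thesis by (simp add: sublist_Cons_right)
qed

lemma not_sublist_zero_zero:
  assumes "n \<ge> 1"
  shows "\<not> sublist [\<zero>, \<zero>] (\<zero> # replicate n \<one> @ [\<zero>])"
proof -
  obtain k where k: "n = Suc k" using assms by (cases n) auto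
  then have snoc: "replicate n \<one> = replicate k \<one> @ [\<one>]"
    by (simp add: replicate_append_same)
  have "\<not> sublist [\<zero>, \<zero>] (replicate n \<one>)" by (simp add: sublist_replicate_iff)
  moreover have "\<not> suffix [\<zero>, \<zero>] (replicate n \<one> @ [\<zero>])"
    using snoc suffix_snoc[of "[\<zero>, \<zero>]" "replicate n \<one>" "\<zero>"] by auto
  ultimately have "\<not> sublist [\<zero>, \<zero>] (replicate n \<one> @ [\<zero>])" by (simp only: sublist_snoc simp_thms)
  moreover have "\<not> prefix [\<zero>] (replicate n \<one> @ [\<zero>])" using k by simp
  ultimately show ?thesis by (simp add: sublist_Cons_right[of _ "\<zero>"])
qed

lemma card_sym_diff_MAW_le:
  fixes S :: "bin list"
  shows "card (sym_diff (MAW S) (MAW (S @ [\<zero>]))) \<le> max 3 (length S)"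
proof -
  let ?T = "S @ [\<zero>]" and ?d = "length S"
  obtain l where l: "recurs_upto S (\<zero>) l"
    using ex_recurs_upto[of S "\<zero>"] by blast
  have "\<not> sublist ?T S" using sublist_length_le by fastforce
  then have "l \<le> ?d" using recurs_uptoD[OF l, of ?T] by simp
  \<comment> \<open>\<open>?T\<close> has \<open>?d + 1\<close> letters, so \<open>l + 1\<close> of
    them remain.\<close>
  define p where "p = drop (?d - l) ?T"
  have p: "suffix p ?T" "length p = Suc l" using \<open>l \<le> ?d\<close> by (auto simp: p_def suffix_drop)
  let ?N = "{p @ [\<zero>], p @ [\<one>]} \<inter> MAW ?T"
  note bound = card_sym_diff_le[OF p l]
  have "card ?N \<le> card {p @ [\<zero>], p @ [\<one>]}" by (intro card_mono) auto
  then have N2: "card ?N \<le> 2" by simp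
  have lens: "length ` left_ext S (\<zero>) \<subseteq> {l + 2..?d}"
    using length_left_ext_ge[OF _ l] length_left_ext_le by fastforce
  consider "l = 0" | "l \<ge> 1" "\<exists>w \<in> left_ext S (\<zero>). length w = ?d"
    | "l \<ge> 1" "\<forall>w \<in> left_ext S (\<zero>). length w \<noteq> ?d"
    by (cases "l = 0") auto
  then show ?thesis
  proof cases
    case 1
    have "\<not> sublist [\<zero>] S" using recurs_uptoD[OF l, of "[\<zero>]"] 1 by simp
    then have "\<zero> \<notin> set S" by (auto simp: in_set_conv_decomp sublist_def)
    then have "S = replicate ?d \<one>" using bin.exhaust by (metis replicate_eqI)
    then have "left_ext S (\<zero>) = {}" using left_ext_replicate by metis
    then show ?thesis using bound N2 by simp
  next
    case 2
    then obtain w where w: "w \<in> left_ext S (\<zero>)" "length w = ?d" by blast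
    then have d: "?d \<ge> 3" using length_left_ext_ge[OF w(1) l] 2 by simp
    obtain n where n: "?d = Suc (Suc n)" using d by (cases ?d; cases "?d - 1") auto
    have S: "S = \<zero> # replicate (Suc n) \<one>" using left_ext_length_eq[OF w d] n by simp
    then have S': "?T = (\<zero> # replicate n \<one>) @ [\<one>, \<zero>]"
      by (simp add: replicate_append_same)
    have suf: "suffix [\<one>, \<zero>] ?T" unfolding S' by (rule suffixI) simp
    have "\<not> sublist [\<one>, \<zero>] S" using not_sublist_one_zero[of 0 "Suc n"] S by simp
    then have "l = 1" using recurs_uptoD[OF l suf] 2 by simp
    then have "p = [\<one>, \<zero>]" using p suf by (intro same_length_suffix_eq[of p ?T]) auto
    \<comment> \<open>This is the tail of \<open>p @ [\<zero>]\<close>, which is therefore not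
      minimal. The total is then at most \<open>1 + 1 + (?d - 2)\<close>.\<close>
    moreover have "\<not> sublist [\<zero>, \<zero>] ?T" using not_sublist_zero_zero[of "Suc n"] S by simp
    ultimately have "?N \<subseteq> {p @ [\<one>]}" by (auto simp: MAW_iff)
    then have "card ?N \<le> card {p @ [\<one>]}" by (intro card_mono) auto
    then show ?thesis using bound card_left_ext_le[OF lens] \<open>l = 1\<close> d by simp
  next
    case 3
    then have "length ` left_ext S (\<zero>) \<subseteq> {l + 2..?d - 1}" using lens by fastforce
    \<comment> \<open>As \<open>l \<ge> 1\<close>, at most \<open>?d - 3\<close> left extensions
      remain; truncated subtraction gives the value 3 for short strings.\<close>
    then show ?thesis using bound card_left_ext_le N2 3(1) by fastforce
  qed
qed

section \<open>Strings attaining the bound\<close>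

lemma sym_diff_MAW_tight_small:
  assumes "n \<ge> 1"
  shows "3 \<le> card (sym_diff (MAW (replicate n \<one>)) (MAW (replicate n \<one> @ [\<zero>])))"
proof -
  let ?S = "replicate n \<one>"
  obtain k where k: "?S = replicate k \<one> @ [\<one>]" using assms by (cases n) (auto simp: replicate_append_same)
  have z: "\<not> sublist [\<zero>] ?S" "\<not> sublist [\<zero>, x] ?S" for x by (auto simp: sublist_replicate_iff)
  have o: "sublist [\<one>] ?S" unfolding k by simp
  have s: "\<not> suffix [\<zero>, x] (?S @ [\<zero>])" for x
    using suffix_snoc[of "[\<zero>, x]" ?S "\<zero>"] k by auto
  have "{[\<zero>], [\<zero>, \<zero>], [\<zero>, \<one>]} \<subseteq> sym_diff (MAW ?S) (MAW (?S @ [\<zero>]))"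
    using z o s by (auto simp: MAW_iff sublist_snoc)
  then have "card {[\<zero>], [\<zero>, \<zero>], [\<zero>, \<one>]} \<le> card (sym_diff (MAW ?S) (MAW (?S @ [\<zero>])))"
    by (intro card_mono finite_UnI finite_Diff finite_MAW)
  then show ?thesis by simp
qed

text \<open>One lost word \<open>[\<one>, \<zero>]\<close>, its right extension by
  \<open>\<one>\<close>, and \<open>n - 1\<close> left extensions add up to \<open>n + 1\<close>,
  the length of the string.\<close>

lemma sym_diff_MAW_tight_large:
  assumes "n \<ge> 2"
  shows "Suc n \<le> card (sym_diff (MAW (\<zero> # replicate n \<one>)) (MAW (\<zero> # replicate n \<one> @ [\<zero>])))"
proof -
  let ?S = "\<zero> # replicate n \<one>"
  let ?f = "\<lambda>m. \<zero> # replicate m \<one> @ [\<zero>]"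
  obtain k where k: "?S = \<zero> # replicate k \<one> @ [\<one>]"
    using assms by (cases n) (auto simp: replicate_append_same)
  \<comment> \<open>For \<open>m = 0\<close> the tail \<open>[\<zero>]\<close> already occurs in
    \<open>?S\<close>; for \<open>m = n\<close> the word is the whole extended string.\<close>
  have f: "?f m \<in> left_ext ?S (\<zero>)" if "m \<in> {1..n - 1}" for m
  proof -
    have r: "replicate n \<one> = replicate m \<one> @ replicate (n - m) \<one>"
      "replicate n \<one> = replicate (n - m) \<one> @ replicate m \<one>"
      using that assms by (auto simp flip: replicate_add)
    have "sublist (\<zero> # replicate m \<one>) ?S" using r(1) by (metis append_Cons sublist_append_rightI)
    moreover have "suffix (replicate m \<one>) ?S" using r(2) by (metis append_Cons suffixI)
    moreover have "\<not> suffix (\<zero> # replicate m \<one>) ?S"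
    proof
      assume "suffix (\<zero> # replicate m \<one>) ?S"
      then have "suffix (\<zero> # replicate m \<one>) (replicate n \<one>)"
        using that assms by (auto simp: suffix_Cons dest: arg_cong[where f = length])
      then show False by (auto dest: set_mono_suffix)
    qed
    moreover have "\<not> sublist (replicate m \<one> @ [\<zero>]) ?S"
      using not_sublist_one_zero[of "m - 1" n] that by (cases m) auto
    ultimately show ?thesis unfolding left_ext_def by blast
  qed
  have f': "?f ` {1..n - 1} \<subseteq> MAW (?S @ [\<zero>]) - MAW ?S"
    by (rule image_subsetI, rule subsetD[OF left_ext_subset], rule f)
  obtain j where j: "n = Suc j" using assms by (cases n) auto
  have S: "sublist [\<zero>] ?S" "sublist [\<one>] ?S" "sublist [\<zero>, \<one>] ?S"
    unfolding j by (auto simp: sublist_Cons_right)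
  have S': "\<not> sublist [\<one>, \<zero>] ?S" using not_sublist_one_zero[of 0 n] by simp
  have s: "suffix [\<one>, \<zero>] (?S @ [\<zero>])" unfolding k by (simp add: suffix_def)
  have "\<not> sublist [\<one>, \<zero>, \<one>] ?S"
    using S' sublist_order.order.trans[of "[\<one>, \<zero>]" "[\<one>, \<zero>, \<one>]" ?S] by (auto simp: sublist_Cons_right)
  then have "{[\<one>, \<zero>], [\<one>, \<zero>, \<one>]} \<subseteq> sym_diff (MAW ?S) (MAW (?S @ [\<zero>]))"
    using S S' s suffix_snoc[of "[\<one>, \<zero>, \<one>]" ?S "\<zero>"]
    by (auto simp: MAW_iff sublist_snoc simp del: append_Cons)
  then have "card ({[\<one>, \<zero>], [\<one>, \<zero>, \<one>]} \<union> ?f ` {1..n - 1})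
      \<le> card (sym_diff (MAW ?S) (MAW (?S @ [\<zero>])))"
    using f' by (intro card_mono finite_UnI finite_Diff finite_MAW) blast
  moreover have "card ({[\<one>, \<zero>], [\<one>, \<zero>, \<one>]} \<union> ?f ` {1..n - 1}) = 2 + card (?f ` {1..n - 1})"
    by (subst card_Un_disjoint) auto
  moreover have "inj_on ?f {1..n - 1}" by (rule inj_onI) (auto dest: arg_cong[where f = length])
  ultimately show ?thesis using assms by (simp add: card_image)
qed

theorem corollary4:
  fixes d :: nat
  assumes "d \<ge> 1"
  shows "(\<forall>S :: bin list. length S = d \<longrightarrow>
            card (sym_diff (MAW S) (MAW (S @ [\<zero>]))) \<le> max 3 d)
       \<and> (\<exists>S :: bin list. length S = d \<and>
            card (sym_diff (MAW S) (MAW (S @ [\<zero>]))) = max 3 d)"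
proof -
  have "\<exists>S :: bin list. length S = d \<and> max 3 d \<le> card (sym_diff (MAW S) (MAW (S @ [\<zero>])))"
  proof (cases "d \<le> 3")
    case True
    then show ?thesis using sym_diff_MAW_tight_small[OF assms]
      by (intro exI[of _ "replicate d \<one>"]) simp
  next
    case False
    then show ?thesis using sym_diff_MAW_tight_large[of "d - 1"]
      by (intro exI[of _ "\<zero> # replicate (d - 1) \<one>"]) simp
  qed
  then show ?thesis using card_sym_diff_MAW_le by (metis le_antisym)
qed

end
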